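(* Let $g,f\in\mathcal{F}_0$, and let $(t_{n,k})_{n,k\ge 0}$ be the lower-triangular matrix defined by $$t_{n,k}=[x^{n-k}]\,g(x)f(x)^n .$$ Then $(t_{n,k})$ is the Riordan array $$\left(g\left(\operatorname{Rev}\left(\tfrac{x}{f(x)}\right)\right)\frac{x\left(\operatorname{Rev}\left(\tfrac{x}{f(x)}\right)\right)'}{\operatorname{Rev}\left(\tfrac{x}{f(x)}\right)},\ \operatorname{Rev}\left(\tfrac{x}{f(x)}\right)\right).$$
   Context: All power series are formal power series in $x$ with coefficients in $\mathbb{Q}$. $\mathcal{F}_0$ is the set of series $a_0+a_1x+a_2x^2+\cdots$ with $a_0\neq 0$; $\mathcal{F}_1$ is the set of series $a_1x+a_2x^2+\cdots$ with $a_1\ne 0$. $[x^m]$ extracts the coefficient of $x^m$ (and is $0$ for $m<0$). For $v\in\mathcal{F}_1$, $\operatorname{Rev}(v)\in\mathcal{F}_1$ denotes its compositional inverse. A prime denotes the formal derivative with respect to $x$. For $w\in\mathcal{F}_1$, quotients such as $xw'/w$ are understood as power series after cancelling the factor $x$. For $u\in\mathcal{F}_0$, $v\in\mathcal{F}_1$, the Riordan array $(u,v)=(u(x),v(x))$ is the infinite lower-triangular matrix, indexed by $n,k\ge 0$, with $(n,k)$ entry $[x^n]\,u(x)v(x)^k$. *)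

theory Defs
  imports "HOL-Computational_Algebra.Formal_Power_Series"
begin

definition F0 :: "rat fps set" where
  "F0 = {a. fps_nth a 0 \<noteq> 0}"

definition F1 :: "rat fps set" where
  "F1 = {a. fps_nth a 0 = 0 \<and> fps_nth a 1 \<noteq> 0}"

(* Infinite matrices are functions of the row index n and the column index k.
   A Riordan array additionally requires u in F0 and v in F1; these
   memberships are stated separately wherever riordan is used. *)
definition riordan :: "rat fps \<Rightarrow> rat fps \<Rightarrow> nat \<Rightarrow> nat \<Rightarrow> rat" where
  "riordan u v n k = fps_nth (u * v ^ k) n"

(* fps_nth takes a natural index, so the convention that the coefficient of a
   negative power of x is 0 is written out for k > n. *)
definition coeff_array :: "rat fps \<Rightarrow> rat fps \<Rightarrow> nat \<Rightarrow> nat \<Rightarrow> rat" where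
  "coeff_array g f n k = (if k \<le> n then fps_nth (g * f ^ n) (n - k) else 0)"

end

theory Submission
  imports Defs
begin

text \<open>
  Lagrange inversion by a change of variable. For \<open>w = x / f\<close> the coefficient \<open>[x\<^sup>n] A\<close>
  is the residue of \<open>A / x\<^sup>n\<^sup>+\<^sup>1\<close>; substituting \<open>w\<close> gives
  \<open>[x\<^sup>n] A = [x\<^sup>n] A(w) f\<^sup>n\<^sup>+\<^sup>1 w'\<close>. Apply this to \<open>A = g(r) (x r'/r) r\<^sup>k\<close> with \<open>r = Rev w\<close>:
  since \<open>r(w) = x\<close> and \<open>r'(w) w' = 1\<close>, the right-hand side collapses to
  \<open>[x\<^sup>n] x\<^sup>k g f\<^sup>n\<close>.
\<close>

unbundle fps_syntax

lemma fps_compose_mult_nth: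
  fixes a b c :: "'a :: comm_ring_1 fps"
  assumes "b $ 0 = 0"
  shows "((a oo b) * c) $ n = (\<Sum>i\<le>n. a $ i * (b ^ i * c) $ n)"
proof -
  \<comment> \<open>Since \<open>b ^ i\<close> has order at least \<open>i\<close>, the terms with
    \<open>m < i\<close> vanish; the common bound \<open>n\<close> for all \<open>m\<close> lets the
    two sums be swapped.\<close>
  have "(\<Sum>i\<le>n. a $ i * (b ^ i) $ m) = (a oo b) $ m" if "m \<le> n" for m
    unfolding fps_compose_nth atLeast0AtMost
    using that assms
    by (intro sum.mono_neutral_right) (auto simp: startsby_zero_power_prefix)
  then have "((a oo b) * c) $ n = (\<Sum>m\<le>n. (\<Sum>i\<le>n. a $ i * (b ^ i) $ m) * c $ (n - m))"
    by (simp add: fps_mult_nth atLeast0AtMost)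
  also have "\<dots> = (\<Sum>i\<le>n. a $ i * (b ^ i * c) $ n)"
    unfolding fps_mult_nth atLeast0AtMost sum_distrib_left sum_distrib_right
    by (subst sum.swap) (simp add: mult.assoc)
  finally show ?thesis .
qed

text \<open>With \<open>w = x/f\<close> this is the residue of \<open>w'/w^(m+1)\<close>: a
  derivative for \<open>m > 0\<close>, a logarithmic derivative for \<open>m = 0\<close>. Laurent
  series are avoided by rewriting the product as \<open>f^m - x f' f^(m-1)\<close>.\<close>

lemma lagrange_kernel_nth:
  fixes f :: "'a :: field_char_0 fps"
  assumes "f $ 0 \<noteq> 0"
  shows "(f ^ Suc m * fps_deriv (fps_X / f)) $ m = (if m = 0 then 1 else 0)"
proof -
  let ?h = "inverse f"
  have hf: "f * ?h = 1"
    using assms by (simp add: inverse_mult_eq_1')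
  have d: "fps_deriv (fps_X / f) = ?h - fps_X * fps_deriv f * ?h ^ 2"
    using assms by (simp add: fps_divide_unit fps_inverse_deriv power2_eq_square algebra_simps)
  show ?thesis
  proof (cases m)
    case 0
    then show ?thesis using assms by (simp add: d fps_mult_nth)
  next
    case (Suc l)
    have "f ^ Suc m * fps_deriv (fps_X / f)
        = (f * ?h) * f ^ m - fps_X * fps_deriv f * (f * ?h) ^ 2 * f ^ l"
      unfolding d Suc by (simp add: algebra_simps power2_eq_square)
    also have "\<dots> = f ^ m - fps_X * (fps_deriv f * f ^ l)"
      by (simp add: hf mult.assoc)
    finally have e: "f ^ Suc m * fps_deriv (fps_X / f) = f ^ m - fps_X * (fps_deriv f * f ^ l)" .
    \<comment> \<open>Comparing coefficients of \<open>x^l\<close> in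
      \<open>(f^m)' = m f' f^l\<close> and cancelling \<open>m\<close>, by characteristic 0, makes
      the two terms of the difference agree at \<open>x^m\<close>.\<close>
    have "fps_deriv (f ^ m) = of_nat m * (fps_deriv f * f ^ l)"
      by (simp add: Suc fps_deriv_power' mult_ac del: power_Suc of_nat_Suc)
    then have "of_nat m * (f ^ m) $ m = of_nat m * (fps_deriv f * f ^ l) $ l"
      using fps_deriv_nth[of "f ^ m" l] unfolding Suc
      by (simp add: fps_of_nat[symmetric] del: of_nat_Suc)
    then have "(f ^ m) $ m = (fps_deriv f * f ^ l) $ l"
      using Suc by (simp del: of_nat_Suc)
    then show ?thesis
      unfolding e using Suc by simp
  qed
qed

text \<open>Expand \<open>a(w)\<close> in powers of \<open>w\<close>; the kernel keeps only the term
  \<open>i = n\<close>.\<close>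

lemma fps_nth_change_of_variable:
  fixes a f :: "'a :: field_char_0 fps"
  assumes "f $ 0 \<noteq> 0"
  defines "w \<equiv> fps_X / f"
  shows "a $ n = ((a oo w) * (f ^ Suc n * fps_deriv w)) $ n"
proof -
  have w: "w = fps_X * inverse f"
    using assms by (simp add: fps_divide_unit)
  have "(w ^ i * (f ^ Suc n * fps_deriv w)) $ n = (if i = n then 1 else 0)" if "i \<le> n" for i
  proof -
    obtain m where n: "n = i + m"
      using \<open>i \<le> n\<close> le_Suc_ex by blast
    \<comment> \<open>As \<open>w f = x\<close>, the factor \<open>w^i\<close> absorbs
      \<open>f^i\<close> and shifts by \<open>i\<close>, leaving the kernel with
      \<open>m = n - i\<close>.\<close>
    have "w ^ i * (f ^ Suc n * fps_deriv w)
        = fps_X ^ i * ((f * inverse f) ^ i * (f ^ Suc m * fps_deriv w))"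
      by (simp add: w n power_mult_distrib power_add mult_ac)
    also have "\<dots> = fps_X ^ i * (f ^ Suc m * fps_deriv w)"
      using assms by (simp add: inverse_mult_eq_1')
    finally have "(w ^ i * (f ^ Suc n * fps_deriv w)) $ n = (f ^ Suc m * fps_deriv w) $ m"
      by (simp only: fps_X_power_mult_nth) (simp add: n)
    then show ?thesis
      using lagrange_kernel_nth[OF assms(1), of m] n by (simp only: w_def) simp
  qed
  then have "(\<Sum>i\<le>n. a $ i * (w ^ i * (f ^ Suc n * fps_deriv w)) $ n)
      = (\<Sum>i\<le>n. if i = n then a $ i else 0)"
    by (intro sum.cong) (simp_all del: power_Suc)
  then have "(\<Sum>i\<le>n. a $ i * (w ^ i * (f ^ Suc n * fps_deriv w)) $ n) = a $ n"
    by simp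
  moreover have "w $ 0 = 0"
    by (simp add: w)
  ultimately show ?thesis
    by (subst fps_compose_mult_nth) simp_all
qed

theorem proposition2:
  fixes g f :: "rat fps"
  assumes "g \<in> F0" and "f \<in> F0"
  shows "let r = fps_inv (fps_X / f);
             u = (g oo r) * (fps_X * fps_deriv r / r)
         in u \<in> F0 \<and> r \<in> F1 \<and> coeff_array g f = riordan u r"
proof -
  define w where "w = fps_X / f"
  define r where "r = fps_inv w"
  define q where "q = fps_X * fps_deriv r / r"
  have f0: "f $ 0 \<noteq> 0" and g0: "g $ 0 \<noteq> 0"
    using assms by (auto simp: F0_def)
  have w: "w = fps_X * inverse f"
    using f0 by (simp add: w_def fps_divide_unit)
  have w0: "w $ 0 = 0" and w1: "w $ 1 \<noteq> 0"
    using f0 by (simp_all add: w)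
  have r0: "r $ 0 = 0" and r1: "r $ 1 \<noteq> 0"
    using w1 by (simp_all add: r_def fps_inv_def)
  have rw: "r oo w = fps_X"
    unfolding r_def by (rule fps_inv[OF w0 w1])
  \<comment> \<open>Divisibility makes the quotient \<open>q\<close> exact: \<open>r\<close> has
    order 1 and the numerator order at least 1.\<close>
  have "r dvd fps_X * fps_deriv r"
  proof -
    have "r \<noteq> 0"
      using r1 by auto
    moreover have "fps_deriv r \<noteq> 0"
      using r1 by (auto simp: fps_eq_iff intro: exI[of _ 0])
    moreover have "subdegree r = 1"
      using r0 r1 by (intro subdegreeI) auto
    ultimately show ?thesis
      by (simp add: fps_dvd_iff)
  qed
  then have qr: "q * r = fps_X * fps_deriv r"
    by (simp add: q_def)
  have "q $ 0 * r $ 1 = r $ 1"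
    using arg_cong[OF qr, of "\<lambda>a. a $ 1"] r0 by (simp add: fps_mult_nth)
  then have q0: "q $ 0 = 1"
    using r1 by simp
  \<comment> \<open>Composing \<open>q r = x r'\<close> with \<open>w\<close> and applying the chain
    rule to \<open>r(w) = x\<close> gives \<open>x q(w) w' = w = x/f\<close>; then \<open>x\<close>
    cancels.\<close>
  have "fps_X * ((q oo w) * fps_deriv w) = ((q * r) oo w) * fps_deriv w"
    using w0 by (simp add: fps_compose_mult_distrib rw mult_ac)
  also have "\<dots> = w * ((fps_deriv r oo w) * fps_deriv w)"
    using w0 by (simp add: qr fps_compose_mult_distrib)
  also have "(fps_deriv r oo w) * fps_deriv w = 1"
    using fps_compose_deriv[OF w0, of r] by (simp add: rw)
  finally have "fps_X * ((q oo w) * fps_deriv w) = fps_X * inverse f"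
    by (simp add: w)
  then have qw: "(q oo w) * fps_deriv w = inverse f"
    by simp
  have grw: "(g oo r) oo w = g"
    using fps_compose_assoc[OF w0 r0, of g] by (simp add: rw)
  have "coeff_array g f n k = riordan ((g oo r) * q) r n k" for n k
  proof -
    have "riordan ((g oo r) * q) r n k
        = ((((g oo r) * q * r ^ k) oo w) * (f ^ Suc n * fps_deriv w)) $ n"
      unfolding riordan_def w_def by (rule fps_nth_change_of_variable[OF f0])
    \<comment> \<open>One of the \<open>n + 1\<close> factors \<open>f\<close> is set aside to
      cancel \<open>q(w) w' = 1/f\<close>.\<close>
    also have "(((g oo r) * q * r ^ k) oo w) * (f ^ Suc n * fps_deriv w)
        = fps_X ^ k * (g * (((q oo w) * fps_deriv w) * f) * f ^ n)"
      using w0 by (simp add: fps_compose_mult_distrib fps_compose_power[symmetric] grw rw mult_ac)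
    also have "\<dots> = fps_X ^ k * (g * f ^ n)"
      unfolding qw using f0 by (simp add: inverse_mult_eq_1)
    \<comment> \<open>The shift by \<open>x^k\<close> also yields the entry 0 for
      \<open>k > n\<close>.\<close>
    finally show ?thesis
      by (simp add: coeff_array_def fps_X_power_mult_nth)
  qed
  moreover have "(g oo r) * q \<in> F0"
    using g0 q0 by (simp add: F0_def)
  moreover have "r \<in> F1"
    using r0 r1 by (simp add: F1_def)
  ultimately show ?thesis
    by (auto simp: Let_def r_def q_def w_def fun_eq_iff)
qed

end
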